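(* For every $s\in[0,1]$ the limit $$\vec{D}u(s) := \lim_{t \to s,\ t \in [0, 1],\ t\neq s}\pi\big(\operatorname{sgn}(t-s)\,(u(t) - u(s))\big)$$ exists in $\mathbb{P}^1(\mathbb{R})$, and $s\mapsto \vec{D}u(s)$ is an injective, continuous function from $[0,1]$ to $\mathbb{P}^1(\mathbb{R})$.
   Context: Let $M_0 = \frac{1}{5}\begin{pmatrix} 5 & 2 & 2\\ 0 & 2 & 1\\ 0 & 1 & 2 \end{pmatrix}$ and $M_1 = \frac{1}{5}\begin{pmatrix} 2 & 0 & 1\\ 2 & 5 & 2\\ 1 & 0 & 2 \end{pmatrix}$, and let $h_0(x) = \frac{x}{2}$, $h_1(x) = \frac{x+1}{2}$. Let $u:[0,1]\to\mathbb{R}^3$ be the unique continuous function satisfying $u(0) = (1,0,0)^T$, $u(1) = (0,1,0)^T$, $u\circ h_0 = M_0\circ u$ and $u \circ h_1 = M_1\circ u$ on $[0,1]$ (this function is known to exist, to be unique, and to be injective; all its values lie in the affine plane $x+y+z=1$). Let $\vec{\mathcal{H}} = \{(x,y,z)\in\mathbb{R}^3 : x+y+z=0\}$, and let $\pi:\vec{\mathcal{H}}\setminus\{0\}\to\mathbb{P}^1(\mathbb{R})$ be the canonical projection onto the projective line of $\vec{\mathcal{H}}$ (the space of vector lines in $\vec{\mathcal{H}}$). *)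

theory Defs
  imports "HOL-Analysis.Analysis"
begin

definition M0 :: "real^3^3" where
  "M0 = (1/5) *\<^sub>R vector [vector [5, 2, 2],
                            vector [0, 2, 1],
                            vector [0, 1, 2]]"

definition M1 :: "real^3^3" where
  "M1 = (1/5) *\<^sub>R vector [vector [2, 0, 1],
                            vector [2, 5, 2],
                            vector [1, 0, 2]]"

definition h0 :: "real \<Rightarrow> real" where
  "h0 x = x / 2"

definition h1 :: "real \<Rightarrow> real" where
  "h1 x = (x + 1) / 2"

definition plane_H :: "(real^3) set" where
  "plane_H = {v. v$1 + v$2 + v$3 = 0}"

text \<open>The projective line of \<open>plane_H\<close>: its points are the vector lines of
  \<open>plane_H\<close>, and its topology is the quotient (final) topology induced by the
  canonical projection \<open>proj\<close> from \<open>plane_H - {0}\<close>.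
  The projection is total, but \<open>proj 0 = {0}\<close> is not a point of the projective line,
  so no junk value is identified with a line.\<close>

definition lines_H :: "(real^3) set set" where
  "lines_H = {L. subspace L \<and> L \<subseteq> plane_H \<and> dim L = 1}"

definition proj :: "real^3 \<Rightarrow> (real^3) set" where
  "proj v = span {v}"

definition P1_H :: "(real^3) set topology" where
  "P1_H = topology (\<lambda>U. U \<subseteq> lines_H \<and>
     openin (top_of_set (plane_H - {0})) {v \<in> plane_H - {0}. proj v \<in> U})"

lemma subspace_plane_H: "subspace plane_H"
proof -
  have "c * x + c * y + c * z = 0" if "x + y + z = 0" for c x y z :: real
  proof -
    have "c * x + c * y + c * z = c * (x + y + z)" by (simp only: distrib_left)
    then show ?thesis using that by simp
  qed
  then show ?thesis
    by (simp add: plane_H_def subspace_def)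
qed

lemma proj_in_lines_H:
  assumes "v \<in> plane_H" "v \<noteq> 0"
  shows "proj v \<in> lines_H"
  using assms span_minimal[OF _ subspace_plane_H, of "{v}"]
  by (auto simp: lines_H_def proj_def dim_insert)

lemma lines_H_cases:
  assumes "L \<in> lines_H"
  obtains v where "v \<in> plane_H" "v \<noteq> 0" "norm v = 1" "L = proj v"
proof -
  have L: "subspace L" "L \<subseteq> plane_H" "dim L = 1"
    using assms by (auto simp: lines_H_def)
  have "\<not> L \<subseteq> {0}"
    using L(3) dim_eq_0[of L] by auto
  then obtain w where w: "w \<in> L" "w \<noteq> 0"
    by blast
  define v where "v = (1 / norm w) *\<^sub>R w"
  have v: "v \<in> L" "v \<noteq> 0" "norm v = 1"
    using w L(1) by (auto simp: v_def subspace_scale)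
  have "span {v} = span L"
  proof (rule dim_eq_span)
    show "dim L \<le> dim {v}"
      using v(2) L(3) by (simp add: dim_insert)
  qed (use v in auto)
  then have "L = proj v"
    using L(1) by (simp add: proj_def span_eq_iff[THEN iffD2])
  with that v L(2) show thesis
    by blast
qed

lemma proj_image: "proj ` (plane_H - {0}) = lines_H"
  by (blast intro: proj_in_lines_H elim: lines_H_cases)

lemma openin_P1_H:
  "openin P1_H U \<longleftrightarrow> U \<subseteq> lines_H \<and>
     openin (top_of_set (plane_H - {0})) {v \<in> plane_H - {0}. proj v \<in> U}"
proof -
  let ?T = "top_of_set (plane_H - {0})"
  let ?pre = "\<lambda>U. {v \<in> plane_H - {0}. proj v \<in> U}"
  have "istopology (\<lambda>U. U \<subseteq> lines_H \<and> openin ?T (?pre U))"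
    unfolding istopology_def
  proof (intro conjI allI impI)
    fix S T assume "S \<subseteq> lines_H \<and> openin ?T (?pre S)" "T \<subseteq> lines_H \<and> openin ?T (?pre T)"
    moreover have "?pre (S \<inter> T) = ?pre S \<inter> ?pre T" by auto
    ultimately show "S \<inter> T \<subseteq> lines_H" "openin ?T (?pre (S \<inter> T))"
      by (blast, simp only: openin_Int)
  next
    fix K assume K: "\<forall>U\<in>K. U \<subseteq> lines_H \<and> openin ?T (?pre U)"
    then show "\<Union>K \<subseteq> lines_H" by blast
    have "?pre (\<Union>K) = \<Union>(?pre ` K)" by auto
    then show "openin ?T (?pre (\<Union>K))"
      by (simp only:) (use K in \<open>blast intro: openin_Union\<close>)
  qed
  then show ?thesis
    by (simp add: P1_H_def topology_inverse')
qed

lemma topspace_P1_H: "topspace P1_H = lines_H"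
proof
  show "topspace P1_H \<subseteq> lines_H"
    unfolding topspace_def openin_P1_H by auto
  have "{v \<in> plane_H - {0}. proj v \<in> lines_H} = plane_H - {0}"
    using proj_in_lines_H by auto
  then have "openin P1_H lines_H"
    by (simp add: openin_P1_H)
  then show "lines_H \<subseteq> topspace P1_H"
    by (rule openin_subset)
qed

lemma quotient_map_proj: "quotient_map (top_of_set (plane_H - {0})) P1_H proj"
  by (simp add: quotient_map_def topspace_P1_H openin_P1_H proj_image)

text \<open>Limits in the projective line are unique, so the definite description in
  \<open>dir_deriv\<close> below is meaningful.\<close>

lemma Hausdorff_P1_H: "Hausdorff_space P1_H"
  unfolding Hausdorff_space_def
proof (intro allI impI, elim conjE)
  fix K L assume "K \<in> topspace P1_H" "L \<in> topspace P1_H" "K \<noteq> L"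
  then obtain v w where v: "v \<in> plane_H" "v \<noteq> 0" "norm v = 1" "K = proj v"
    and w: "w \<in> plane_H" "w \<noteq> 0" "norm w = 1" "L = proj w"
    by (metis lines_H_cases topspace_P1_H)
  define A where "A a b = {M \<in> lines_H. \<forall>x\<in>M - {0}. \<bar>x \<bullet> b\<bar> < \<bar>x \<bullet> a\<bar>}" for a b :: "real^3"
  have pre: "{x \<in> plane_H - {0}. proj x \<in> A a b}
      = (plane_H - {0}) \<inter> {x. \<bar>x \<bullet> b\<bar> < \<bar>x \<bullet> a\<bar>}" for a b
  proof (intro set_eqI iffI)
    fix x assume "x \<in> {x \<in> plane_H - {0}. proj x \<in> A a b}"
    then show "x \<in> (plane_H - {0}) \<inter> {x. \<bar>x \<bullet> b\<bar> < \<bar>x \<bullet> a\<bar>}"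
      by (auto simp: A_def proj_def span_base)
  next
    fix x assume "x \<in> (plane_H - {0}) \<inter> {x. \<bar>x \<bullet> b\<bar> < \<bar>x \<bullet> a\<bar>}"
    then show "x \<in> {x \<in> plane_H - {0}. proj x \<in> A a b}"
      using proj_in_lines_H[of x] by (auto simp: A_def proj_def span_singleton abs_mult mult_less_cancel_left)
  qed
  have op: "openin P1_H (A a b)" for a b
    unfolding openin_P1_H pre
    by (intro conjI openin_open_Int open_Collect_less continuous_intros) (auto simp: A_def)
  have "\<bar>v \<bullet> w\<bar> < 1"
  proof -
    have "\<bar>v \<bullet> w\<bar> \<le> 1"
      using Cauchy_Schwarz_ineq2[of v w] v w by simp
    moreover have "\<bar>v \<bullet> w\<bar> \<noteq> 1"
    proof
      assume "\<bar>v \<bullet> w\<bar> = 1"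
      then have "v = w \<or> v = - w"
        using norm_cauchy_schwarz_abs_eq[of v w] v(3) w(3) by auto
      then have "v \<in> span {w}" "w \<in> span {v}"
        using span_base[of w "{w}"] span_neg[of w "{w}"] span_base[of v "{v}"] span_neg[of v "{v}"]
        by auto
      then have "span {v} = span {w}"
        by (simp add: span_eq)
      then show False
        using \<open>K \<noteq> L\<close> v(4) w(4) by (simp add: proj_def)
    qed
    ultimately show ?thesis by simp
  qed
  moreover have "v \<bullet> v = 1" "w \<bullet> w = 1"
    using v(3) w(3) by (simp_all add: norm_eq_1)
  ultimately have "v \<in> (plane_H - {0}) \<inter> {x. \<bar>x \<bullet> w\<bar> < \<bar>x \<bullet> v\<bar>}"
      "w \<in> (plane_H - {0}) \<inter> {x. \<bar>x \<bullet> v\<bar> < \<bar>x \<bullet> w\<bar>}"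
    using v(1,2) w(1,2) by (simp_all add: inner_commute)
  then have "K \<in> A v w" "L \<in> A w v"
    unfolding pre[symmetric] using v(4) w(4) by simp_all
  moreover have "disjnt (A v w) (A w v)"
  proof -
    have "M \<notin> A w v" if "M \<in> A v w" for M
    proof -
      from that obtain x where "x \<in> M" "x \<noteq> 0"
        unfolding A_def proj_def by (blast intro: span_base elim: lines_H_cases[unfolded proj_def])
      with that show ?thesis by (force simp: A_def)
    qed
    then show ?thesis by (auto simp: disjnt_def)
  qed
  ultimately show "\<exists>U V. openin P1_H U \<and> openin P1_H V \<and> K \<in> U \<and> L \<in> V \<and> disjnt U V"
    using op by blast
qed

definition secant_dir :: "(real \<Rightarrow> real^3) \<Rightarrow> real \<Rightarrow> real \<Rightarrow> (real^3) set" where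
  "secant_dir u s t = proj (sgn (t - s) *\<^sub>R (u t - u s))"

definition dir_deriv :: "(real \<Rightarrow> real^3) \<Rightarrow> real \<Rightarrow> (real^3) set" where
  "dir_deriv u s = (THE L. limitin P1_H (secant_dir u s) L (at s within {0..1}))"

end

theory Submission
  imports Defs
begin

text \<open>
  On the direction plane \<open>x + y + z = 0\<close>, take the coordinates \<open>p = y - z\<close> and \<open>q = z - x\<close>.
  In them the linear parts of the two maps are
  \<open>(p, q) \<mapsto> (p, p + 3 q) / 5\<close> and \<open>(p, q) \<mapsto> (3 p + q, q) / 5\<close>: both preserve the quadrant
  \<open>p \<ge> 0, q \<ge> 0\<close>. By self-similarity \<open>y - z\<close> and \<open>z - x\<close> are nondecreasing along the curve
  (\<open>coordinates_mono\<close>), and \<open>y - x\<close> is strictly increasing (\<open>R_less\<close>). So every secant, oriented by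
  increasing parameter, points into the quadrant, and its line is described by one number
  \<open>q / (p + q)\<close> in \<open>[0, 1]\<close>, here called its slope.

  On slopes the two maps act by \<open>g0 x = (1 + 2 x) / (2 + x)\<close> and \<open>g1 x = x / (3 - x)\<close>. Both contract
  \<open>[0, 1]\<close> by the factor \<open>3/4\<close>, their images \<open>[1/2, 1]\<close> and \<open>[0, 1/2]\<close> meet only in \<open>1/2\<close>, and
  \<open>g0 0 = g1 1 = 1/2\<close>. The contraction forces all secants inside one dyadic interval of length
  \<open>2 ^ -n\<close> to have nearly the same slope. The common value \<open>1/2\<close> is what makes the slopes fit
  together across a dyadic point, where the left piece ends in the digits \<open>0111\<dots>\<close> and the right
  piece starts with \<open>1000\<dots>\<close>. Together they say that all secants within any interval of length
  \<open>2 ^ -n\<close> have slopes within \<open>(3/4) ^ n\<close> of one value (\<open>slope_near_point\<close>). Hence secants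
  converge to a tangent at every parameter, at a uniform rate, and the tangent slope is
  continuous.

  The tangent slope \<open>\<tau>\<close> inherits \<open>\<tau> (s / 2) = g0 (\<tau> s)\<close> and \<open>\<tau> ((s + 1) / 2) = g1 (\<tau> s)\<close>. If
  \<open>\<tau> s = \<tau> t\<close> with \<open>s < t\<close>, injectivity of \<open>g0\<close> and \<open>g1\<close> lets one zoom in until \<open>s < 1/2 < t\<close>.
  Then both slopes equal \<open>1/2\<close>, which on the left half is attained only at its right end
  (\<open>tangent_neq_across_mid\<close>). So \<open>\<tau>\<close> is injective (\<open>inj_tangent\<close>), and it remains to
  carry \<open>\<tau>\<close> over to the projective line by the continuous injection \<open>m \<mapsto> proj (dir_vec m)\<close>.
\<close>

section \<open>The projective action of the two maps\<close>

text \<open>The slope \<open>q / (p + q)\<close> of the image of the direction \<open>(p, q)\<close> with slope \<open>x\<close>, that is, of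
  \<open>(p, p + 3 q)\<close> for \<open>g0\<close> and of \<open>(3 p + q, q)\<close> for \<open>g1\<close>.\<close>

definition g0 :: "real \<Rightarrow> real" where "g0 x = (1 + 2 * x) / (2 + x)"
definition g1 :: "real \<Rightarrow> real" where "g1 x = x / (3 - x)"

lemma g0_diff: "0 \<le> x \<Longrightarrow> 0 \<le> y \<Longrightarrow> g0 x - g0 y = 3 / ((2 + x) * (2 + y)) * (x - y)"
  by (simp add: g0_def divide_simps) (simp add: algebra_simps)

lemma g1_diff: "x \<le> 1 \<Longrightarrow> y \<le> 1 \<Longrightarrow> g1 x - g1 y = 3 / ((3 - x) * (3 - y)) * (x - y)"
  by (simp add: g1_def divide_simps) (simp add: algebra_simps)

lemma g0_contraction:
  assumes "0 \<le> x" "0 \<le> y"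
  shows "\<bar>g0 x - g0 y\<bar> \<le> 3/4 * \<bar>x - y\<bar>"
proof -
  have "2 * 2 \<le> (2 + x) * (2 + y)"
    by (rule mult_mono) (use assms in auto)
  then have "3 / ((2 + x) * (2 + y)) \<le> 3/4"
    by (intro frac_le) auto
  then show ?thesis
    using mult_right_mono[of "3 / ((2 + x) * (2 + y))" "3/4" "\<bar>x - y\<bar>"] assms
    unfolding g0_diff[OF assms] abs_mult by simp
qed

lemma g1_contraction:
  assumes "x \<le> 1" "y \<le> 1"
  shows "\<bar>g1 x - g1 y\<bar> \<le> 3/4 * \<bar>x - y\<bar>"
proof -
  have "2 * 2 \<le> (3 - x) * (3 - y)"
    by (rule mult_mono) (use assms in auto)
  then have "3 / ((3 - x) * (3 - y)) \<le> 3/4"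
    by (intro frac_le) auto
  then show ?thesis
    using mult_right_mono[of "3 / ((3 - x) * (3 - y))" "3/4" "\<bar>x - y\<bar>"] assms
    unfolding g1_diff[OF assms] abs_mult by simp
qed

lemma g0_range: "0 \<le> x \<Longrightarrow> x \<le> 1 \<Longrightarrow> 1/2 \<le> g0 x \<and> g0 x \<le> 1"
  by (simp add: g0_def field_simps)

lemma g1_range: "0 \<le> x \<Longrightarrow> x \<le> 1 \<Longrightarrow> 0 \<le> g1 x \<and> g1 x \<le> 1/2"
  by (simp add: g1_def field_simps)

lemma g0_inj: "0 \<le> x \<Longrightarrow> 0 \<le> y \<Longrightarrow> g0 x = g0 y \<longleftrightarrow> x = y"
  using g0_diff[of x y] by auto

lemma g1_inj: "x \<le> 1 \<Longrightarrow> y \<le> 1 \<Longrightarrow> g1 x = g1 y \<longleftrightarrow> x = y"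
  using g1_diff[of x y] by auto

lemma g0_values: "g0 0 = 1/2" "g0 1 = 1"
  by (simp_all add: g0_def)

lemma g1_values: "g1 0 = 0" "g1 1 = 1/2"
  by (simp_all add: g1_def)

section \<open>Geometric bounds and binary subdivision\<close>

lemma nonpos_if_geometric_bound:
  fixes x B :: real
  assumes "\<And>n::nat. x \<le> B * (4/5) ^ n"
  shows "x \<le> 0"
proof (rule LIMSEQ_le_const)
  show "(\<lambda>n. B * (4/5) ^ n) \<longlonglongrightarrow> 0"
    by (intro tendsto_mult_right_zero LIMSEQ_power_zero) auto
qed (use assms in auto)

lemma ex_geometric_less:
  assumes "0 < (e::real)"
  obtains n :: nat where "2 * (3/4) ^ n < e"
  using real_arch_pow_inv[of "e / 2" "3/4"] assms by (auto simp: field_simps)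

lemma halves_cases [consumes 1, case_names left right]:
  fixes t :: real
  assumes "t \<in> {0..1}"
  obtains x where "x \<in> {0..1}" "t = x / 2" | x where "x \<in> {0..1}" "t = (x + 1) / 2"
proof (cases "t \<le> 1/2")
  case True
  show ?thesis by (rule that(1)[of "2 * t"]) (use assms True in auto)
next
  case False
  show ?thesis by (rule that(2)[of "2 * t - 1"]) (use assms False in auto)
qed

text \<open>Two parameters either lie in a common half, where self-similarity reduces a claim about them
  to the doubled scale, or are separated by the midpoint.\<close>

lemma halves_pair_cases [consumes 2, case_names left right straddle]:
  fixes s t :: real
  assumes "s \<in> {0..1}" "t \<in> {0..1}"
  obtains x y where "x \<in> {0..1}" "y \<in> {0..1}" "s = x / 2" "t = y / 2"
    | x y where "x \<in> {0..1}" "y \<in> {0..1}" "s = (x + 1) / 2" "t = (y + 1) / 2"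
    | "s < 1/2 \<and> 1/2 < t \<or> t < 1/2 \<and> 1/2 < s"
proof (cases "s \<le> 1/2 \<and> t \<le> 1/2")
  case True
  show ?thesis by (rule that(1)[of "2 * s" "2 * t"]) (use assms True in auto)
next
  case F: False
  show ?thesis
  proof (cases "1/2 \<le> s \<and> 1/2 \<le> t")
    case True
    show ?thesis by (rule that(2)[of "2 * s - 1" "2 * t - 1"]) (use assms True in auto)
  next
    case False
    with F show ?thesis by (intro that(3)) auto
  qed
qed

section \<open>Monotone coordinates along the curve\<close>

text \<open>\<open>P\<close> and \<open>Q\<close> stand for \<open>y - z\<close> and \<open>z - x\<close> along the curve.
  The constant terms \<open>-2\<close> and \<open>2\<close> come from \<open>x + y + z = 1\<close>.\<close>

locale harmonic_edge =
  fixes P Q :: "real \<Rightarrow> real"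
  assumes bounded: "\<exists>B. \<forall>t\<in>{0..1}. \<bar>P t\<bar> \<le> B \<and> \<bar>Q t\<bar> \<le> B"
    and ends: "P 0 = 0" "P 1 = 1" "Q 0 = -1" "Q 1 = 0"
    and P_left: "t \<in> {0..1} \<Longrightarrow> P (t / 2) = P t / 5"
    and Q_left: "t \<in> {0..1} \<Longrightarrow> Q (t / 2) = (P t + 3 * Q t - 2) / 5"
    and P_right: "t \<in> {0..1} \<Longrightarrow> P ((t + 1) / 2) = (3 * P t + Q t + 2) / 5"
    and Q_right: "t \<in> {0..1} \<Longrightarrow> Q ((t + 1) / 2) = Q t / 5"
begin

lemma mid: "P (1/2) = 1/5" "Q (1/2) = -1/5"
  using P_left[of 1] Q_right[of 0] ends by auto

text \<open>Whatever amount the bounds are violated by, passing to a half interval shrinks it to at most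
  \<open>4/5\<close> of the violation at the doubled scale.\<close>

lemma coordinate_bounds:
  assumes "t \<in> {0..1}"
  shows "0 \<le> P t" "P t \<le> 1" "-1 \<le> Q t" "Q t \<le> 0"
proof -
  obtain B where B: "\<And>t. t \<in> {0..1} \<Longrightarrow> \<bar>P t\<bar> \<le> B \<and> \<bar>Q t\<bar> \<le> B"
    using bounded by blast
  have *: "-P t \<le> B * (4/5) ^ n \<and> P t - 1 \<le> B * (4/5) ^ n \<and>
        -1 - Q t \<le> B * (4/5) ^ n \<and> Q t \<le> B * (4/5) ^ n" if "t \<in> {0..1}" for t n
    using that
  proof (induction n arbitrary: t)
    case 0
    then show ?case using B[of t] by auto
  next
    case (Suc n)
    have "0 \<le> B" using B[of 0] by auto
    then have e: "0 \<le> B * (4/5) ^ n" by simp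
    from Suc.prems show ?case
    proof (cases rule: halves_cases)
      case (left x)
      with Suc.IH[OF left(1)] e show ?thesis
        unfolding left(2) P_left[OF left(1)] Q_left[OF left(1)]
        by (auto simp: add_divide_distrib diff_divide_distrib)
    next
      case (right x)
      with Suc.IH[OF right(1)] e show ?thesis
        unfolding right(2) P_right[OF right(1)] Q_right[OF right(1)]
        by (auto simp: add_divide_distrib diff_divide_distrib)
    qed
  qed
  show "0 \<le> P t" "P t \<le> 1" "-1 \<le> Q t" "Q t \<le> 0"
    using *[OF assms] nonpos_if_geometric_bound[of "-P t" B] nonpos_if_geometric_bound[of "P t - 1" B]
      nonpos_if_geometric_bound[of "-1 - Q t" B] nonpos_if_geometric_bound[of "Q t" B] by auto
qed

lemma left_of_mid:
  assumes "s \<in> {0..1}" "s \<le> 1/2"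
  shows "P s \<le> P (1/2)" "Q s \<le> Q (1/2)"
  using P_left[of "2 * s"] Q_left[of "2 * s"] coordinate_bounds[of "2 * s"] assms mid by auto

lemma right_of_mid:
  assumes "t \<in> {0..1}" "1/2 \<le> t"
  shows "P (1/2) \<le> P t" "Q (1/2) \<le> Q t"
  using P_right[of "2 * t - 1"] Q_right[of "2 * t - 1"] coordinate_bounds[of "2 * t - 1"] assms mid by auto

text \<open>The same shrinking of violations works for pairs in a common half. Pairs separated by the
  midpoint need a separate reason, since there the two halves would each contribute an error; the
  bounds on either side of the midpoint show that such pairs violate nothing.\<close>

lemma coordinates_mono:
  assumes "s \<in> {0..1}" "t \<in> {0..1}" "s \<le> t"
  shows "P s \<le> P t" "Q s \<le> Q t"
proof -
  have *: "P s - P t \<le> 1 * (4/5) ^ n \<and> Q s - Q t \<le> 1 * (4/5) ^ n"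
    if "s \<in> {0..1}" "t \<in> {0..1}" "s \<le> t" for s t n
    using that
  proof (induction n arbitrary: s t)
    case 0
    then show ?case using coordinate_bounds[of s] coordinate_bounds[of t] by auto
  next
    case (Suc n)
    define e where "e = (4/5 :: real) ^ n"
    have e: "0 \<le> e" by (simp add: e_def)
    from Suc.prems(1,2) show ?case
    proof (cases rule: halves_pair_cases)
      case (left x y)
      have "x \<le> y" using Suc.prems(3) left(3,4) by simp
      with Suc.IH[OF left(1,2)] e show ?thesis
        unfolding left(3,4) P_left[OF left(1)] P_left[OF left(2)] Q_left[OF left(1)] Q_left[OF left(2)]
          power_Suc e_def[symmetric] by (auto simp: add_divide_distrib diff_divide_distrib)
    next
      case (right x y)
      have "x \<le> y" using Suc.prems(3) right(3,4) by simp
      with Suc.IH[OF right(1,2)] e show ?thesis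
        unfolding right(3,4) P_right[OF right(1)] P_right[OF right(2)] Q_right[OF right(1)] Q_right[OF right(2)]
          power_Suc e_def[symmetric] by (auto simp: add_divide_distrib diff_divide_distrib)
    next
      case straddle
      then have "P s \<le> P t \<and> Q s \<le> Q t"
        using Suc.prems left_of_mid[of s] right_of_mid[of t] by auto
      then show ?thesis using e unfolding power_Suc e_def[symmetric] by auto
    qed
  qed
  show "P s \<le> P t" "Q s \<le> Q t"
    using *[OF assms] nonpos_if_geometric_bound[of "P s - P t" 1] nonpos_if_geometric_bound[of "Q s - Q t" 1] by auto
qed

definition R :: "real \<Rightarrow> real" where "R t = P t + Q t"

lemma R_left: "t \<in> {0..1} \<Longrightarrow> R (t / 2) = (2 * P t + 3 * Q t - 2) / 5"
  and R_right: "t \<in> {0..1} \<Longrightarrow> R ((t + 1) / 2) = (3 * P t + 2 * Q t + 2) / 5"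
  by (simp_all add: R_def P_left Q_left P_right Q_right)

lemma R_less_left:
  assumes "s \<in> {0..1}" "t \<in> {0..1}" "s \<le> t" "R s < R t"
  shows "R (s / 2) < R (t / 2)"
  using coordinates_mono[OF assms(1-3)] assms(4)
  unfolding R_left[OF assms(1)] R_left[OF assms(2)] by (simp add: R_def)

lemma R_less_right:
  assumes "s \<in> {0..1}" "t \<in> {0..1}" "s \<le> t" "R s < R t"
  shows "R ((s + 1) / 2) < R ((t + 1) / 2)"
  using coordinates_mono[OF assms(1-3)] assms(4)
  unfolding R_right[OF assms(1)] R_right[OF assms(2)] by (simp add: R_def)

text \<open>Strictness cannot be obtained in one induction on the distance of the parameters: a pair
  straddling the midpoint splits into intervals that may be much shorter. For such a pair it is
  enough that one of the two pieces increases, so intervals ending at \<open>1\<close> come first.\<close>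

lemma R_less_end:
  assumes "0 \<le> s" "s < 1"
  shows "R s < R 1"
proof -
  have *: "R s < R 1" if "0 \<le> s" "s \<le> 1 - (1/2) ^ n" for s and n :: nat
    using that
  proof (induction n arbitrary: s)
    case 0
    then show ?case by (auto simp: R_def ends)
  next
    case (Suc n)
    show ?case
    proof (cases "s \<le> 1/2")
      case True
      then show ?thesis using left_of_mid[of s] Suc.prems mid by (auto simp: R_def ends)
    next
      case False
      have "s \<le> 1" using Suc.prems(2) zero_le_power[of "1/2::real" "Suc n"] by linarith
      with False show ?thesis
        using R_less_right[of "2 * s - 1" 1] Suc.IH[of "2 * s - 1"] Suc.prems by auto
    qed
  qed
  obtain n :: nat where "(1/2) ^ n < 1 - s"
    using real_arch_pow_inv[of "1 - s" "1/2"] assms by auto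
  then show ?thesis using *[of s n] assms by auto
qed

lemma R_less:
  assumes "s \<in> {0..1}" "t \<in> {0..1}" "s < t"
  shows "R s < R t"
proof -
  have *: "R s < R t" if "s \<in> {0..1}" "t \<in> {0..1}" "s + (1/2) ^ n \<le> t" for s t and n :: nat
    using that
  proof (induction n arbitrary: s t)
    case 0
    then have "s = 0" "t = 1" by auto
    then show ?case by (auto simp: R_def ends)
  next
    case (Suc n)
    have lt: "s < t" using Suc.prems(3) zero_less_power[of "1/2::real" "Suc n"] by linarith
    from Suc.prems(1,2) show ?case
    proof (cases rule: halves_pair_cases)
      case (left x y)
      have "x + (1/2) ^ n \<le> y" using Suc.prems(3) unfolding left(3,4) power_Suc by linarith
      with Suc.IH[OF left(1,2)] lt R_less_left[OF left(1,2)] show ?thesis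
        unfolding left(3,4) by auto
    next
      case (right x y)
      have "x + (1/2) ^ n \<le> y" using Suc.prems(3) unfolding right(3,4) by (simp add: add_divide_distrib diff_divide_distrib)
      with Suc.IH[OF right(1,2)] lt R_less_right[OF right(1,2)] show ?thesis
        unfolding right(3,4) by auto
    next
      case straddle
      then have st: "s < 1/2" "1/2 < t" using lt by auto
      have "R s < R (1/2)"
        using R_less_left[of "2 * s" 1] R_less_end[of "2 * s"] Suc.prems st by auto
      also have "\<dots> \<le> R t"
        using right_of_mid[of t] Suc.prems st by (auto simp: R_def)
      finally show ?thesis .
    qed
  qed
  obtain n :: nat where "(1/2) ^ n < t - s"
    using real_arch_pow_inv[of "t - s" "1/2"] assms by auto
  then show ?thesis using *[of s t n] assms by auto
qed

lemma R_neq: "s \<in> {0..1} \<Longrightarrow> t \<in> {0..1} \<Longrightarrow> s \<noteq> t \<Longrightarrow> R s \<noteq> R t"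
  using R_less[of s t] R_less[of t s] by (cases "s < t") auto

section \<open>Slopes of secants\<close>

text \<open>The expression is symmetric in \<open>s\<close> and \<open>t\<close>, because a line carries no orientation; on the
  diagonal it is \<open>0\<close>.\<close>

definition slope :: "real \<Rightarrow> real \<Rightarrow> real" where
  "slope s t = (Q t - Q s) / (R t - R s)"

lemma slope_commute: "slope s t = slope t s"
  using minus_divide_divide[of "Q t - Q s" "R t - R s"] by (simp add: slope_def)

lemma slope_range:
  assumes "s \<in> {0..1}" "t \<in> {0..1}"
  shows "0 \<le> slope s t \<and> slope s t \<le> 1"
proof -
  have *: "0 \<le> slope s t \<and> slope s t \<le> 1" if "s \<in> {0..1}" "t \<in> {0..1}" "s < t" for s t
    using R_less[OF that] coordinates_mono[of s t] that
    by (simp add: slope_def) (simp add: R_def)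
  consider "s < t" | "s = t" | "t < s" by linarith
  then show ?thesis
    using *[of s t] *[of t s] assms slope_commute[of s t]
    by cases (auto simp: slope_def)
qed

lemma slope_left:
  assumes "s \<in> {0..1}" "t \<in> {0..1}" "s < t"
  shows "slope (s / 2) (t / 2) = g0 (slope s t)"
proof -
  have "0 < R t - R s" using R_less[OF assms] by simp
  moreover have "0 < 2 * (R t - R s) + (Q t - Q s)"
    using R_less[OF assms] coordinates_mono[of s t] assms by simp
  moreover have "Q (t/2) - Q (s/2) = ((R t - R s) + 2 * (Q t - Q s)) / 5"
    unfolding Q_left[OF assms(1)] Q_left[OF assms(2)] R_def by (simp add: field_simps)
  moreover have "R (t/2) - R (s/2) = (2 * (R t - R s) + (Q t - Q s)) / 5"
    unfolding R_left[OF assms(1)] R_left[OF assms(2)] by (simp add: R_def field_simps)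
  ultimately show ?thesis
    unfolding slope_def g0_def by (simp only:) (simp add: divide_simps, simp add: algebra_simps)
qed

lemma slope_right:
  assumes "s \<in> {0..1}" "t \<in> {0..1}" "s < t"
  shows "slope ((s + 1) / 2) ((t + 1) / 2) = g1 (slope s t)"
proof -
  have "0 < R t - R s" using R_less[OF assms] by simp
  moreover have "0 < 3 * (R t - R s) - (Q t - Q s)"
    using R_less[OF assms] coordinates_mono[of s t] assms by (simp add: R_def)
  moreover have "Q ((t + 1)/2) - Q ((s + 1)/2) = (Q t - Q s) / 5"
    unfolding Q_right[OF assms(1)] Q_right[OF assms(2)] by simp
  moreover have "R ((t + 1)/2) - R ((s + 1)/2) = (3 * (R t - R s) - (Q t - Q s)) / 5"
    unfolding R_right[OF assms(1)] R_right[OF assms(2)] by (simp add: R_def field_simps)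
  ultimately show ?thesis
    unfolding slope_def g1_def by (simp only:) (simp add: divide_simps, simp add: algebra_simps)
qed

text \<open>Close to the endpoint \<open>0\<close> only \<open>g0\<close> acts, so slopes are attracted by its fixed point \<open>1\<close>;
  likewise close to \<open>1\<close> by the fixed point \<open>0\<close> of \<open>g1\<close>.\<close>

lemma slope_near_0:
  assumes "0 \<le> s" "s < t" "t \<le> (1/2) ^ n"
  shows "\<bar>slope s t - 1\<bar> \<le> (3/4) ^ n"
  using assms
proof (induction n arbitrary: s t)
  case 0
  then show ?case using slope_range[of s t] by auto
next
  case (Suc n)
  have b: "2 * t \<le> (1/2) ^ n" "2 * t \<le> 1"
    using Suc.prems(3) power_le_one[of "1/2::real" n] by auto
  then have m: "2 * s \<in> {0..1}" "2 * t \<in> {0..1}" "2 * s < 2 * t" using Suc.prems by auto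
  have "slope s t = g0 (slope (2 * s) (2 * t))"
    using slope_left[OF m] by simp
  then show ?case
    using g0_contraction[of "slope (2 * s) (2 * t)" 1] slope_range[OF m(1,2)]
      Suc.IH[of "2 * s" "2 * t"] Suc.prems b by (simp add: g0_values)
qed

lemma slope_near_1:
  assumes "1 - (1/2) ^ n \<le> s" "s < t" "t \<le> 1"
  shows "\<bar>slope s t\<bar> \<le> (3/4) ^ n"
  using assms
proof (induction n arbitrary: s t)
  case 0
  then show ?case using slope_range[of s t] by auto
next
  case (Suc n)
  have b: "1 - (1/2) ^ n \<le> 2 * s - 1" "0 \<le> 2 * s - 1"
    using Suc.prems(1) power_le_one[of "1/2::real" n] by auto
  then have m: "2 * s - 1 \<in> {0..1}" "2 * t - 1 \<in> {0..1}" "2 * s - 1 < 2 * t - 1" using Suc.prems by auto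
  have "slope s t = g1 (slope (2 * s - 1) (2 * t - 1))"
    using slope_right[OF m] by simp
  then show ?case
    using g1_contraction[of "slope (2 * s - 1) (2 * t - 1)" 0] slope_range[OF m(1,2)]
      Suc.IH[of "2 * s - 1" "2 * t - 1"] Suc.prems b by (simp add: g1_values)
qed

text \<open>A chord across two adjacent arcs has a slope between theirs: its increments are the sums of
  theirs and the denominators are positive.\<close>

lemma slope_mediant:
  assumes "r \<in> {0..1}" "s \<in> {0..1}" "t \<in> {0..1}" "r < s" "s < t"
    and "\<bar>slope r s - v\<bar> \<le> e" "\<bar>slope s t - v\<bar> \<le> e"
  shows "\<bar>slope r t - v\<bar> \<le> e"
proof -
  have p: "0 < R s - R r" "0 < R t - R s"
    using assms R_less[of r s] R_less[of s t] by auto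
  have "(v - e) * (R s - R r) \<le> Q s - Q r" "Q s - Q r \<le> (v + e) * (R s - R r)"
       "(v - e) * (R t - R s) \<le> Q t - Q s" "Q t - Q s \<le> (v + e) * (R t - R s)"
    using assms(6,7) p by (auto simp: slope_def abs_le_iff field_simps)
  then have "(v - e) * (R t - R r) \<le> Q t - Q r" "Q t - Q r \<le> (v + e) * (R t - R r)"
    by (auto simp: algebra_simps)
  moreover have "0 < R t - R r" using p by simp
  ultimately show ?thesis by (auto simp: slope_def abs_le_iff field_simps)
qed

text \<open>Left of the midpoint, \<open>g0\<close> is applied to slopes near \<open>0\<close>, right of it \<open>g1\<close> to slopes near \<open>1\<close>;
  both give slopes near \<open>g0 0 = g1 1 = 1/2\<close>.\<close>

lemma slope_near_mid:
  assumes "s \<in> {0..1}" "t \<in> {0..1}" "1/2 - (1/2) ^ Suc n \<le> s" "s < t" "t \<le> 1/2 + (1/2) ^ Suc n"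
  shows "\<bar>slope s t - 1/2\<bar> \<le> (3/4) ^ Suc n"
proof -
  have L: "\<bar>slope s t - 1/2\<bar> \<le> (3/4) ^ Suc n"
    if "s \<in> {0..1}" "1/2 - (1/2) ^ Suc n \<le> s" "s < t" "t \<le> 1/2" for s t
  proof -
    have m: "2 * s \<in> {0..1}" "2 * t \<in> {0..1}" "2 * s < 2 * t" using that by auto
    have "slope s t = g0 (slope (2 * s) (2 * t))" using slope_left[OF m] by simp
    then show ?thesis
      using g0_contraction[of "slope (2 * s) (2 * t)" 0] slope_range[OF m(1,2)]
        slope_near_1[of n "2 * s" "2 * t"] that by (simp add: g0_values)
  qed
  have U: "\<bar>slope s t - 1/2\<bar> \<le> (3/4) ^ Suc n"
    if "t \<in> {0..1}" "1/2 \<le> s" "s < t" "t \<le> 1/2 + (1/2) ^ Suc n" for s t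
  proof -
    have m: "2 * s - 1 \<in> {0..1}" "2 * t - 1 \<in> {0..1}" "2 * s - 1 < 2 * t - 1" using that by auto
    have "slope s t = g1 (slope (2 * s - 1) (2 * t - 1))" using slope_right[OF m] by simp
    then show ?thesis
      using g1_contraction[of "slope (2 * s - 1) (2 * t - 1)" 1] slope_range[OF m(1,2)]
        slope_near_0[of "2 * s - 1" "2 * t - 1" n] that by (simp add: g1_values)
  qed
  consider "t \<le> 1/2" | "1/2 \<le> s" | "s < 1/2" "1/2 < t" by linarith
  then show ?thesis
  proof cases
    case 3
    then show ?thesis
      using assms by (intro slope_mediant[of s "1/2" t] L U) auto
  qed (use L U assms in auto)
qed

text \<open>The central estimate. An interval within one half is handled at the doubled scale, and one
  that contains the midpoint by the previous lemma. Quantifying over all intervals of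
  length \<open>2 ^ -n\<close>, not only the dyadic ones, makes it apply on both sides of a parameter at once.\<close>

lemma slope_near_point:
  "\<exists>v\<in>{0..1}. \<forall>s\<in>{0..1}. \<forall>t\<in>{0..1}. c \<le> s \<longrightarrow> s < t \<longrightarrow> t \<le> c + (1/2) ^ n
     \<longrightarrow> \<bar>slope s t - v\<bar> \<le> (3/4) ^ n"
proof (induction n arbitrary: c)
  case 0
  have "\<bar>slope s t - 0\<bar> \<le> (3/4) ^ 0" if "s \<in> {0..1}" "t \<in> {0..1}" for s t
    using slope_range[OF that] by simp
  then show ?case by (intro bexI[of _ 0]) auto
next
  case (Suc n)
  consider "c + (1/2) ^ Suc n \<le> 1/2" | "1/2 \<le> c" | "c < 1/2" "1/2 < c + (1/2) ^ Suc n" by linarith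
  then show ?case
  proof cases
    case 1
    obtain v where v: "v \<in> {0..1}" and V: "\<And>s t. \<lbrakk>s \<in> {0..1}; t \<in> {0..1}; 2 * c \<le> s; s < t;
        t \<le> 2 * c + (1/2) ^ n\<rbrakk> \<Longrightarrow> \<bar>slope s t - v\<bar> \<le> (3/4) ^ n"
      using Suc[of "2 * c"] by blast
    have "\<bar>slope s t - g0 v\<bar> \<le> (3/4) ^ Suc n"
      if "s \<in> {0..1}" "t \<in> {0..1}" "c \<le> s" "s < t" "t \<le> c + (1/2) ^ Suc n" for s t
    proof -
      have m: "2 * s \<in> {0..1}" "2 * t \<in> {0..1}" "2 * s < 2 * t" using that 1 by auto
      have "slope s t = g0 (slope (2 * s) (2 * t))" using slope_left[OF m] by simp
      then show ?thesis
        using g0_contraction[of "slope (2 * s) (2 * t)" v] slope_range[OF m(1,2)] v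
          V[OF m(1,2)] that by simp
    qed
    moreover have "g0 v \<in> {0..1}" using g0_range[of v] v by auto
    ultimately show ?thesis by blast
  next
    case 2
    obtain v where v: "v \<in> {0..1}" and V: "\<And>s t. \<lbrakk>s \<in> {0..1}; t \<in> {0..1}; 2 * c - 1 \<le> s; s < t;
        t \<le> 2 * c - 1 + (1/2) ^ n\<rbrakk> \<Longrightarrow> \<bar>slope s t - v\<bar> \<le> (3/4) ^ n"
      using Suc[of "2 * c - 1"] by blast
    have "\<bar>slope s t - g1 v\<bar> \<le> (3/4) ^ Suc n"
      if "s \<in> {0..1}" "t \<in> {0..1}" "c \<le> s" "s < t" "t \<le> c + (1/2) ^ Suc n" for s t
    proof -
      have m: "2 * s - 1 \<in> {0..1}" "2 * t - 1 \<in> {0..1}" "2 * s - 1 < 2 * t - 1" using that 2 by auto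
      have "slope s t = g1 (slope (2 * s - 1) (2 * t - 1))" using slope_right[OF m] by simp
      then show ?thesis
        using g1_contraction[of "slope (2 * s - 1) (2 * t - 1)" v] slope_range[OF m(1,2)] v
          V[OF m(1,2)] that by simp
    qed
    moreover have "g1 v \<in> {0..1}" using g1_range[of v] v by auto
    ultimately show ?thesis by blast
  next
    case 3
    then have "\<bar>slope s t - 1/2\<bar> \<le> (3/4) ^ Suc n"
      if "s \<in> {0..1}" "t \<in> {0..1}" "c \<le> s" "s < t" "t \<le> c + (1/2) ^ Suc n" for s t
      using that by (intro slope_near_mid) auto
    then show ?thesis by (intro bexI[of _ "1/2"]) auto
  qed
qed

lemma slope_cauchy:
  assumes "s \<in> {0..1}" "t \<in> {0..1}" "t' \<in> {0..1}" "s \<noteq> t" "s \<noteq> t'"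
    and "\<bar>t - s\<bar> \<le> (1/2) ^ Suc n" "\<bar>t' - s\<bar> \<le> (1/2) ^ Suc n"
  shows "\<bar>slope s t - slope s t'\<bar> \<le> 2 * (3/4) ^ n"
proof -
  obtain v where V: "\<And>x y. \<lbrakk>x \<in> {0..1}; y \<in> {0..1}; s - (1/2) ^ Suc n \<le> x; x < y;
        y \<le> s - (1/2) ^ Suc n + (1/2) ^ n\<rbrakk> \<Longrightarrow> \<bar>slope x y - v\<bar> \<le> (3/4) ^ n"
    using slope_near_point[of "s - (1/2) ^ Suc n" n] by blast
  have "\<bar>slope s y - v\<bar> \<le> (3/4) ^ n"
    if "y \<in> {0..1}" "s \<noteq> y" "\<bar>y - s\<bar> \<le> (1/2) ^ Suc n" for y
  proof (cases "s < y")
    case True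
    then show ?thesis using that assms(1) by (intro V) auto
  next
    case False
    then have "\<bar>slope y s - v\<bar> \<le> (3/4) ^ n" using that assms(1) by (intro V) auto
    then show ?thesis by (simp add: slope_commute)
  qed
  from this[of t] this[of t'] show ?thesis using assms by auto
qed

section \<open>The tangent slope\<close>

text \<open>The case distinction keeps the second point of each secant inside \<open>[0, 1]\<close>.\<close>

definition tangent :: "real \<Rightarrow> real" where
  "tangent s = lim (\<lambda>n. slope s (if s \<le> 1/2 then s + (1/2) ^ Suc n else s - (1/2) ^ Suc n))"

lemma slope_tangent:
  assumes s: "s \<in> {0..1}" and t: "t \<in> {0..1}" "t \<noteq> s" "\<bar>t - s\<bar> \<le> (1/2) ^ Suc n"
  shows "\<bar>slope s t - tangent s\<bar> \<le> 2 * (3/4) ^ n"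
proof -
  define x where "x n = (if s \<le> 1/2 then s + (1/2) ^ Suc n else s - (1/2) ^ Suc n)" for n :: nat
  have x: "x n \<in> {0..1}" "s \<noteq> x n" "\<bar>x n - s\<bar> = (1/2) ^ Suc n" for n
  proof -
    define e where "e = (1/2::real) ^ Suc n"
    have "0 < e" "e \<le> 1/2"
      using power_le_one[of "1/2::real" n] by (auto simp: e_def)
    with s show "x n \<in> {0..1}" "s \<noteq> x n" "\<bar>x n - s\<bar> = (1/2) ^ Suc n"
      unfolding x_def e_def[symmetric] by auto
  qed
  have le: "\<bar>x k - s\<bar> \<le> (1/2) ^ Suc n" if "n \<le> k" for n k
    unfolding x(3) by (rule power_decreasing) (use that in auto)
  have "Cauchy (\<lambda>n. slope s (x n))"
  proof (rule metric_CauchyI)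
    fix e :: real assume "0 < e"
    then obtain N :: nat where "(3/4) ^ N < e / 2"
      using real_arch_pow_inv[of "e / 2" "3/4"] by auto
    then have "dist (slope s (x m)) (slope s (x n)) < e" if "N \<le> m" "N \<le> n" for m n
      using slope_cauchy[OF s x(1)[of m] x(1)[of n] x(2) x(2) le[OF that(1)] le[OF that(2)]]
      by (simp add: dist_real_def)
    then show "\<exists>N. \<forall>m\<ge>N. \<forall>n\<ge>N. dist (slope s (x m)) (slope s (x n)) < e" by blast
  qed
  then have "(\<lambda>k. slope s (x k)) \<longlonglongrightarrow> tangent s"
    unfolding tangent_def x_def Cauchy_convergent_iff convergent_LIMSEQ_iff .
  then have "(\<lambda>k. \<bar>slope s t - slope s (x k)\<bar>) \<longlonglongrightarrow> \<bar>slope s t - tangent s\<bar>"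
    by (intro tendsto_intros)
  moreover have "\<bar>slope s t - slope s (x k)\<bar> \<le> 2 * (3/4) ^ n" if "n \<le> k" for k
    using slope_cauchy[OF s t(1) x(1) t(2)[symmetric] x(2) t(3) le[OF that]] .
  ultimately show ?thesis by (intro LIMSEQ_le_const2) blast+
qed

lemma slope_tendsto_tangent:
  assumes s: "s \<in> {0..1}"
  shows "(slope s \<longlongrightarrow> tangent s) (at s within {0..1})"
proof (rule tendstoI)
  fix e :: real assume "0 < e"
  then obtain n :: nat where n: "2 * (3/4) ^ n < e" by (rule ex_geometric_less)
  show "\<forall>\<^sub>F t in at s within {0..1}. dist (slope s t) (tangent s) < e"
    unfolding eventually_at
  proof (intro exI conjI ballI impI)
    fix t assume "t \<in> {0..1}" "t \<noteq> s \<and> dist t s < (1/2) ^ Suc n"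
    then show "dist (slope s t) (tangent s) < e"
      using slope_tangent[OF s, of t n] n by (simp add: dist_real_def)
  qed simp
qed

lemma continuous_tangent: "continuous_on {0..1} tangent"
  unfolding continuous_on_iff
proof (intro ballI allI impI)
  fix s e :: real assume s: "s \<in> {0..1}" and "0 < e"
  then obtain n :: nat where n: "2 * (3/4) ^ n < e / 2" using ex_geometric_less[of "e / 2"] by auto
  have "dist (tangent t) (tangent s) < e"
    if t: "t \<in> {0..1}" and d: "dist t s < (1/2) ^ Suc n" for t
  proof (cases "t = s")
    case True
    then show ?thesis using \<open>0 < e\<close> by simp
  next
    case False
    then show ?thesis
      using slope_tangent[OF s t, of n] slope_tangent[OF t s, of n] d n
      by (simp add: dist_real_def slope_commute[of t s] abs_minus_commute)
  qed
  then show "\<exists>d>0. \<forall>t\<in>{0..1}. dist t s < d \<longrightarrow> dist (tangent t) (tangent s) < e"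
    by (intro exI[of _ "(1/2) ^ Suc n"]) auto
qed

lemma at_unit_nontrivial: "s \<in> {0..1} \<Longrightarrow> at s within {0..1::real} \<noteq> bot"
  by (simp add: trivial_limit_within islimpt_Icc)

lemma tangent_range:
  assumes s: "s \<in> {0..1}"
  shows "0 \<le> tangent s" "tangent s \<le> 1"
proof -
  have ev: "\<forall>\<^sub>F t in at s within {0..1}. 0 \<le> slope s t \<and> slope s t \<le> 1"
    using slope_range[OF s] by (auto simp: eventually_at_filter)
  show "0 \<le> tangent s"
    by (rule tendsto_lowerbound[OF slope_tendsto_tangent[OF s] _ at_unit_nontrivial[OF s]])
      (rule eventually_mono[OF ev], simp)
  show "tangent s \<le> 1"
    by (rule tendsto_upperbound[OF slope_tendsto_tangent[OF s] _ at_unit_nontrivial[OF s]])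
      (rule eventually_mono[OF ev], simp)
qed

text \<open>The two cases of \<open>c\<close> treat the left and the right half together.\<close>

lemma slope_tendsto_half:
  assumes "s \<in> {0..1}" "c \<in> {0, 1}"
  shows "((\<lambda>t. slope ((s + c) / 2) ((t + c) / 2)) \<longlongrightarrow> tangent ((s + c) / 2)) (at s within {0..1})"
proof (rule filterlim_compose[OF slope_tendsto_tangent])
  show "(s + c) / 2 \<in> {0..1}" using assms by auto
  have "((\<lambda>t. (t + c) / 2) \<longlongrightarrow> (s + c) / 2) (at s within {0..1})"
    by (intro tendsto_intros) auto
  moreover have "\<forall>\<^sub>F t in at s within {0..1}. (t + c) / 2 \<in> {0..1} \<and> (t + c) / 2 \<noteq> (s + c) / 2"
    using assms by (auto simp: eventually_at_filter)
  ultimately show "filterlim (\<lambda>t. (t + c) / 2) (at ((s + c) / 2) within {0..1}) (at s within {0..1})"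
    by (auto simp: filterlim_at)
qed

lemma tangent_left:
  assumes s: "s \<in> {0..1}"
  shows "tangent (s / 2) = g0 (tangent s)"
proof (rule tendsto_unique[OF at_unit_nontrivial[OF s]])
  show "((\<lambda>t. slope (s / 2) (t / 2)) \<longlongrightarrow> tangent (s / 2)) (at s within {0..1})"
    using slope_tendsto_half[OF s, of 0] by simp
  have "((\<lambda>t. g0 (slope s t)) \<longlongrightarrow> g0 (tangent s)) (at s within {0..1})"
    unfolding g0_def using tangent_range[OF s]
    by (intro tendsto_intros slope_tendsto_tangent[OF s]) auto
  moreover have "\<forall>\<^sub>F t in at s within {0..1}. slope (s / 2) (t / 2) = g0 (slope s t)"
    using slope_left[OF s] slope_left[OF _ s]
    by (auto simp: eventually_at_filter slope_commute[of s] slope_commute[of "s / 2"] neq_iff)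
  ultimately show "((\<lambda>t. slope (s / 2) (t / 2)) \<longlongrightarrow> g0 (tangent s)) (at s within {0..1})"
    using tendsto_cong by fast
qed

lemma tangent_right:
  assumes s: "s \<in> {0..1}"
  shows "tangent ((s + 1) / 2) = g1 (tangent s)"
proof (rule tendsto_unique[OF at_unit_nontrivial[OF s]])
  show "((\<lambda>t. slope ((s + 1) / 2) ((t + 1) / 2)) \<longlongrightarrow> tangent ((s + 1) / 2)) (at s within {0..1})"
    using slope_tendsto_half[OF s, of 1] by simp
  have "((\<lambda>t. g1 (slope s t)) \<longlongrightarrow> g1 (tangent s)) (at s within {0..1})"
    unfolding g1_def using tangent_range[OF s]
    by (intro tendsto_intros slope_tendsto_tangent[OF s]) auto
  moreover have "\<forall>\<^sub>F t in at s within {0..1}. slope ((s + 1) / 2) ((t + 1) / 2) = g1 (slope s t)"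
    using slope_right[OF s] slope_right[OF _ s]
    by (auto simp: eventually_at_filter slope_commute[of s] slope_commute[of "(s + 1) / 2"] neq_iff)
  ultimately show "((\<lambda>t. slope ((s + 1) / 2) ((t + 1) / 2)) \<longlongrightarrow> g1 (tangent s)) (at s within {0..1})"
    using tendsto_cong by fast
qed

text \<open>The value \<open>0\<close> is outside the image of \<open>g0\<close> and is taken by \<open>g1\<close> only at \<open>0\<close>. So a parameter \<open>s\<close>
  with this tangent slope lies in the right half, and \<open>2 * s - 1\<close> has tangent slope \<open>0\<close> again;
  iterating, all binary digits of \<open>s\<close> are \<open>1\<close>.\<close>

lemma tangent_eq_0D:
  assumes "s \<in> {0..1}" "tangent s = 0"
  shows "s = 1"
proof -
  have *: "1 - s \<le> (1/2) ^ n" if "s \<in> {0..1}" "tangent s = 0" for s and n :: nat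
    using that
  proof (induction n arbitrary: s)
    case (Suc n)
    from Suc.prems(1) show ?case
    proof (cases rule: halves_cases)
      case (right x)
      then have "g1 (tangent x) = g1 0"
        using Suc.prems(2) tangent_right[OF right(1)] unfolding right(2) g1_values by simp
      then have "tangent x = 0" using g1_inj[of "tangent x" 0] tangent_range[OF right(1)] by simp
      then show ?thesis using Suc.IH[OF right(1)] right by simp
    next
      case (left x)
      then show ?thesis
        using Suc.prems(2) g0_range[of "tangent x"] tangent_range[OF left(1)]
        unfolding left(2) tangent_left[OF left(1)] by simp
    qed
  qed auto
  show ?thesis
  proof (rule ccontr)
    assume "s \<noteq> 1"
    then obtain n :: nat where "(1/2) ^ n < 1 - s"
      using real_arch_pow_inv[of "1 - s" "1/2"] assms by auto
    then show False using *[OF assms, of n] by simp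
  qed
qed

text \<open>Equal slopes would lie in the images of both \<open>g0\<close> and \<open>g1\<close>, hence equal \<open>1/2 = g0 0\<close>, and \<open>2 * s\<close>
  would have the tangent slope \<open>0\<close> that belongs to the endpoint \<open>1\<close>.\<close>

lemma tangent_neq_across_mid:
  assumes "s \<in> {0..1}" "t \<in> {0..1}" "s < 1/2" "1/2 < t"
  shows "tangent s \<noteq> tangent t"
proof
  assume eq: "tangent s = tangent t"
  have m: "2 * s \<in> {0..1}" "2 * t - 1 \<in> {0..1}" using assms by auto
  have "tangent s = g0 (tangent (2 * s))" "tangent t = g1 (tangent (2 * t - 1))"
    using tangent_left[OF m(1)] tangent_right[OF m(2)] by simp_all
  with eq have "g0 (tangent (2 * s)) = g0 0"
    using g0_range[of "tangent (2 * s)"] g1_range[of "tangent (2 * t - 1)"]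
      tangent_range[OF m(1)] tangent_range[OF m(2)] by (simp add: g0_values)
  then have "tangent (2 * s) = 0"
    using g0_inj tangent_range[OF m(1)] by simp
  then show False using tangent_eq_0D[OF m(1)] assms by simp
qed

text \<open>Two parameters with the same tangent slope can be doubled together again and again without
  ever being separated by the midpoint, which forces their distance to be \<open>0\<close>.\<close>

lemma inj_tangent: "inj_on tangent {0..1}"
proof (rule inj_onI, rule ccontr)
  fix s t assume st: "s \<in> {0..1}" "t \<in> {0..1}" "tangent s = tangent t" "s \<noteq> t"
  have *: "\<bar>s - t\<bar> \<le> (1/2) ^ n"
    if "s \<in> {0..1}" "t \<in> {0..1}" "tangent s = tangent t" for s t and n :: nat
    using that
  proof (induction n arbitrary: s t)
    case (Suc n)
    from Suc.prems(1,2) show ?case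
    proof (cases rule: halves_pair_cases)
      case (left x y)
      then have "tangent x = tangent y"
        using Suc.prems(3) g0_inj[of "tangent x" "tangent y"]
          tangent_range[OF left(1)] tangent_range[OF left(2)]
        unfolding left(3,4) tangent_left[OF left(1)] tangent_left[OF left(2)] by simp
      then show ?thesis using Suc.IH[OF left(1,2)] unfolding left(3,4) power_Suc by linarith
    next
      case (right x y)
      then have "tangent x = tangent y"
        using Suc.prems(3) g1_inj[of "tangent x" "tangent y"]
          tangent_range[OF right(1)] tangent_range[OF right(2)]
        unfolding right(3,4) tangent_right[OF right(1)] tangent_right[OF right(2)] by simp
      then show ?thesis using Suc.IH[OF right(1,2)] by (simp add: right(3,4) add_divide_distrib abs_if split: if_splits)
    next
      case straddle
      then show ?thesis
        using Suc.prems tangent_neq_across_mid[of s t] tangent_neq_across_mid[of t s] by auto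
    qed
  qed auto
  obtain n :: nat where "(1/2) ^ n < \<bar>s - t\<bar>"
    using real_arch_pow_inv[of "\<bar>s - t\<bar>" "1/2"] st(4) by auto
  then show False using *[OF st(1-3), of n] by simp
qed

end

section \<open>From slopes to the projective line\<close>

text \<open>The vector of the plane with \<open>y - z = 1 - m\<close> and \<open>z - x = m\<close>, so that its slope is \<open>m\<close> and
  \<open>y - x = 1\<close>.\<close>

definition dir_vec :: "real \<Rightarrow> real^3" where
  "dir_vec m = vector [-1/3, 2/3, -1/3] + m *\<^sub>R vector [-1/3, -1/3, 2/3]"

lemma dir_vec_nth:
  "dir_vec m $ 1 = - (1 + m) / 3" "dir_vec m $ 2 = (2 - m) / 3" "dir_vec m $ 3 = (2 * m - 1) / 3"
  by (simp_all add: dir_vec_def field_simps)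

lemma dir_vec_in_plane: "dir_vec m \<in> plane_H - {0}"
proof -
  have "dir_vec m $ 2 - dir_vec m $ 1 = 1" unfolding dir_vec_nth by (simp add: field_simps)
  then have "dir_vec m \<noteq> 0" by auto
  then show ?thesis by (simp add: plane_H_def dir_vec_nth field_simps)
qed

lemma continuous_map_proj_dir_vec: "continuous_map euclideanreal P1_H (\<lambda>m. proj (dir_vec m))"
proof -
  have "continuous_map euclideanreal (top_of_set (plane_H - {0})) dir_vec"
    unfolding continuous_map_in_subtopology dir_vec_def[abs_def]
    using dir_vec_in_plane by (auto simp: dir_vec_def intro!: continuous_intros)
  from continuous_map_compose[OF this quotient_imp_continuous_map[OF quotient_map_proj]]
  show ?thesis by (simp add: o_def)
qed

lemma proj_dir_vec_inject:
  assumes "proj (dir_vec m) = proj (dir_vec n)"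
  shows "m = n"
proof -
  have "dir_vec m \<in> span {dir_vec n}"
    using assms span_base[of "dir_vec m" "{dir_vec m}"] by (simp add: proj_def)
  then obtain k where k: "dir_vec m = k *\<^sub>R dir_vec n" by (auto simp: span_singleton)
  have "dir_vec m $ i = k * dir_vec n $ i" for i using k by simp
  from this[of 1] this[of 2] this[of 3]
  have e: "1 + m = k * (1 + n)" "2 - m = k * (2 - n)"
    by (simp_all add: dir_vec_nth field_simps)
  then have "3 = k * 3" by (simp add: algebra_simps)
  then show ?thesis using e(1) by simp
qed

lemma proj_scale: "c \<noteq> 0 \<Longrightarrow> proj (c *\<^sub>R v) = proj v"
  unfolding proj_def using span_image_scale[of "{v}" "\<lambda>_. c"] by simp

section \<open>The curve\<close>

lemma M0_nth:
  "(M0 *v v) $ 1 = (5 * v$1 + 2 * v$2 + 2 * v$3) / 5"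
  "(M0 *v v) $ 2 = (2 * v$2 + v$3) / 5"
  "(M0 *v v) $ 3 = (v$2 + 2 * v$3) / 5"
  by (simp_all add: M0_def matrix_vector_mult_def sum_3 field_simps)

lemma M1_nth:
  "(M1 *v v) $ 1 = (2 * v$1 + v$3) / 5"
  "(M1 *v v) $ 2 = (2 * v$1 + 5 * v$2 + 2 * v$3) / 5"
  "(M1 *v v) $ 3 = (v$1 + 2 * v$3) / 5"
  by (simp_all add: M1_def matrix_vector_mult_def sum_3 field_simps)

text \<open>The columns of \<open>M0\<close> sum to \<open>1\<close>, so the coordinate sum is unchanged by halving the parameter, and
  continuity at \<open>0\<close> identifies it with its value there.\<close>

lemma coordinate_sum:
  fixes u :: "real \<Rightarrow> real^3"
  assumes cont: "continuous_on {0..1} u" and u0: "u 0 = vector [1, 0, 0]"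
    and left: "\<And>x. x \<in> {0..1} \<Longrightarrow> u (h0 x) = M0 *v u x"
    and t: "t \<in> {0..1}"
  shows "u t $ 1 + u t $ 2 + u t $ 3 = 1"
proof -
  define S where "S x = u x $ 1 + u x $ 2 + u x $ 3" for x
  have half: "S (x / 2) = S x" if "x \<in> {0..1}" for x
    using left[OF that] by (simp add: S_def h0_def M0_nth field_simps)
  have in01: "t * (1/2) ^ n \<in> {0..1}" for n :: nat
    using t mult_le_one[of t "(1/2) ^ n"] power_le_one[of "1/2::real" n] by auto
  have const: "S (t * (1/2) ^ n) = S t" for n :: nat
  proof (induction n)
    case (Suc n)
    then show ?case using half[OF in01[of n]] by simp
  qed simp
  have "continuous_on {0..1} S"
    unfolding S_def by (intro continuous_intros cont)
  moreover have "(\<lambda>n. t * (1/2) ^ n) \<longlonglongrightarrow> 0"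
    by (intro tendsto_mult_right_zero LIMSEQ_power_zero) auto
  ultimately have "(\<lambda>n. S (t * (1/2) ^ n)) \<longlonglongrightarrow> S 0"
    by (rule continuous_on_tendsto_compose) (use in01 in \<open>simp_all only: eventually_True\<close>, simp)
  then have "S t = S 0" unfolding const by (simp add: LIMSEQ_const_iff)
  then show ?thesis by (simp add: S_def u0)
qed

theorem corollary6:
  fixes u :: "real \<Rightarrow> real^3"
  assumes "continuous_on {0..1} u"
    and "u 0 = vector [1, 0, 0]"
    and "u 1 = vector [0, 1, 0]"
    and "\<And>x. x \<in> {0..1} \<Longrightarrow> u (h0 x) = M0 *v u x"
    and "\<And>x. x \<in> {0..1} \<Longrightarrow> u (h1 x) = M1 *v u x"
  shows "(\<forall>s\<in>{0..1}. limitin P1_H (secant_dir u s) (dir_deriv u s) (at s within {0..1}))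
    \<and> inj_on (dir_deriv u) {0..1}
    \<and> continuous_map (top_of_set {0..1}) P1_H (dir_deriv u)"
proof -
  define P Q where "P t = u t $ 2 - u t $ 3" and "Q t = u t $ 3 - u t $ 1" for t
  have sum1: "u t $ 1 + u t $ 2 + u t $ 3 = 1" if "t \<in> {0..1}" for t
    using coordinate_sum[OF assms(1,2,4) that] .
  interpret harmonic_edge P Q
  proof
    have "bounded (u ` {0..1})"
      by (intro compact_imp_bounded compact_continuous_image assms(1)) auto
    then obtain B where B: "\<And>t. t \<in> {0..1} \<Longrightarrow> norm (u t) \<le> B"
      unfolding bounded_iff by blast
    have "\<bar>u t $ i\<bar> \<le> B" if "t \<in> {0..1}" for t i
      using component_le_norm_cart[of "u t" i] B[OF that] by simp
    then have "\<bar>P t\<bar> \<le> 2 * B \<and> \<bar>Q t\<bar> \<le> 2 * B" if "t \<in> {0..1}" for t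
      using that by (smt (verit) P_def Q_def)
    then show "\<exists>B. \<forall>t\<in>{0..1}. \<bar>P t\<bar> \<le> B \<and> \<bar>Q t\<bar> \<le> B" by blast
  next
    fix t :: real assume t: "t \<in> {0..1}"
    note e = assms(4,5)[OF t, unfolded h0_def h1_def] sum1[OF t]
    show "P (t / 2) = P t / 5" "Q (t / 2) = (P t + 3 * Q t - 2) / 5"
      "P ((t + 1) / 2) = (3 * P t + Q t + 2) / 5" "Q ((t + 1) / 2) = Q t / 5"
      using e(3) unfolding P_def Q_def e(1,2) M0_nth M1_nth by (simp_all add: field_simps)
  qed (simp_all add: P_def Q_def assms(2,3))
  \<comment> \<open>The sign only flips the vector, and \<open>u t - u s\<close> is the nonzero multiple by \<open>R t - R s\<close> of
    the representative of its slope.\<close>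
  have secant: "secant_dir u s t = proj (dir_vec (slope s t))"
    if st: "s \<in> {0..1}" "t \<in> {0..1}" "s \<noteq> t" for s t
  proof -
    have "R t - R s \<noteq> 0" using R_neq[OF st] by simp
    then have q: "(R t - R s) * slope s t = Q t - Q s" by (simp add: slope_def)
    have "u t - u s = (R t - R s) *\<^sub>R dir_vec (slope s t)"
    proof -
      have "(R t - R s) * dir_vec (slope s t) $ 1 = - ((R t - R s) + (Q t - Q s)) / 3"
        "(R t - R s) * dir_vec (slope s t) $ 2 = (2 * (R t - R s) - (Q t - Q s)) / 3"
        "(R t - R s) * dir_vec (slope s t) $ 3 = (2 * (Q t - Q s) - (R t - R s)) / 3"
        unfolding dir_vec_nth q[symmetric] by (simp_all add: field_simps)
      then show ?thesis
        using sum1[OF st(1)] sum1[OF st(2)]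
        by (simp add: vec_eq_iff forall_3 R_def P_def Q_def)
    qed
    then show ?thesis
      using \<open>R t - R s \<noteq> 0\<close> st(3) by (simp add: secant_dir_def proj_scale sgn_if)
  qed
  have lim: "limitin P1_H (secant_dir u s) (proj (dir_vec (tangent s))) (at s within {0..1})"
    if s: "s \<in> {0..1}" for s
  proof -
    have "limitin P1_H ((\<lambda>m. proj (dir_vec m)) \<circ> slope s) (proj (dir_vec (tangent s))) (at s within {0..1})"
      using continuous_map_limit[OF continuous_map_proj_dir_vec] slope_tendsto_tangent[OF s] by fastforce
    then show ?thesis
      by (rule limitin_transform_eventually[rotated])
        (use secant[OF s] in \<open>auto simp: eventually_at_filter\<close>)
  qed
  have deriv: "dir_deriv u s = proj (dir_vec (tangent s))" if s: "s \<in> {0..1}" for s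
    unfolding dir_deriv_def
  proof (rule the_equality[of "\<lambda>L. limitin P1_H (secant_dir u s) L (at s within {0..1})", OF lim[OF s]])
    fix L assume "limitin P1_H (secant_dir u s) L (at s within {0..1})"
    then show "L = proj (dir_vec (tangent s))"
      using limitin_Hausdorff_unique[OF _ lim[OF s] at_unit_nontrivial[OF s] Hausdorff_P1_H] by blast
  qed
  have "inj_on (dir_deriv u) {0..1}"
    using inj_tangent proj_dir_vec_inject by (auto simp: inj_on_def deriv)
  moreover have "continuous_map (top_of_set {0..1}) P1_H (dir_deriv u)"
  proof (rule continuous_map_eq)
    show "continuous_map (top_of_set {0..1}) P1_H ((\<lambda>m. proj (dir_vec m)) \<circ> tangent)"
      by (rule continuous_map_compose[OF _ continuous_map_proj_dir_vec]) (simp add: continuous_tangent)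
  qed (simp add: deriv)
  ultimately show ?thesis using lim deriv by simp
qed

end
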